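(* Consider the data-driven linear program $$\mathrm{(LP)}\qquad \max_{\alpha}\ \alpha^\top\int_{\mathbf{Z}}\phi(z)\,c(dz)\quad\text{s.t.}\quad \mathbf{\Phi}^\top\alpha\le\boldsymbol{\ell},$$ with $q(z)=\alpha^\top\phi(z)$ restricted to the class $\mathcal{S}^{\mathrm{quad}}$ of polynomials of degree at most $2$ (all objects are defined in the context). If $q\in\mathcal{S}^{\mathrm{quad}}$, then the solution to (LP) is finite if and only if there exists $\lambda\in\mathbb{R}^N_+\setminus\{0\}$ such that $$\mathrm{mat}(\mathbf{\Phi}\lambda)\succeq 0 .$$ In that case, (LP) is guaranteed to be bounded by selecting $\int_{\mathbf{Z}}\phi(z)\,c(dz)=\mathbf{\Phi}\lambda$ as the cost vector.
   Context: Let $\mathbf{X}\subseteq\mathbb{R}^n$, $\mathbf{U}\subseteq\mathbb{R}^m$, $\mathbf{Z}=\mathbf{X}\times\mathbf{U}$. The dynamics are $x^+=f(x,u)$ with $f:\mathbf{X}\times\mathbf{U}\to\mathbf{X}$, the stage cost is $\ell:\mathbf{X}\times\mathbf{U}\to\mathbb{R}_+$ (nonnegative), and the discount factor is $\gamma\in(0,1)$. Data: for $i=1,\dots,N$, $z_i=(x_i,u_i)\in\mathbf{Z}$, $x_i^+=f(x_i,u_i)$, $w_i\in\mathbf{U}$, $z_i^+=(x_i^+,w_i)\in\mathbf{Z}$, $\ell_i=\ell(z_i)$, and $\boldsymbol{\ell}=[\ell_1\ \cdots\ \ell_N]^\top$. $\mathcal{S}(\mathbf{Z})$ is the vector space of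 real-valued measurable functions on $\mathbf{Z}$ with finite weighted sup-norm (for a fixed positive weight function), and $\mathcal{M}_+(\mathbf{Z})$ is the set of finite nonnegative measures $c$ on $\mathbf{Z}$ with finite weighted total variation and $c(\mathbf{Z})>0$. The measure in (LP) is $c\in\mathcal{M}_+(\mathbf{Z})$. Quadratic features: $p(z)$ is the complete vector of monomials in $z$ of degree at most $1$; $\phi(z)=\mathrm{vec}(p(z)p(z)^\top)$; $\alpha=\mathrm{vec}\,Q$ with $Q$ a symmetric matrix; and $\mathcal{S}^{\mathrm{quad}}$ is the set of $q\in\mathcal{S}(\mathbf{Z})$ of the form $q(z)=\alpha^\top\phi(z)=p(z)^\top Q\,p(z)$. The data matrix is $\mathbf{\Phi}=[\phi(z_1)-\gamma\phi(z_1^+)\ \cdots\ \phi(z_N)-\gamma\phi(z_N^+)]$, and for $\lambda\in\mathbb{R}^N$ the matrix version of $\mathbf{\Phi}\lambda$ is $$\mathrm{mat}(\mathbf{\Phi}\lambda)=\sum_{i=1}^N\lambda_i\left(p(z_i)p(z_i)^\top-\gamma\,p(z_i^+)p(z_i^+)^\top\right).$$ $\mathbb{R}^N_+$ is the set of vectors in $\mathbb{R}^N$ with nonnegative entries, and $\succeq 0$ means positive semidefinite. The "cost vector" of (LP) is the vector $\int_{\mathbf{Z}}\phi(z)\,c(dz)$ multiplying $\alpha$ in the objective.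
   Formalization: As the "if" part fails for a fixed c and for general Z, "finite" is read as finite for some c; "only if" and boundedness with cost vector Φλ hold for all X, U, while the full equivalence and a c with ∫φ dc=Φλ are stated for X=R^n, U=R^m; the entries of φ are assumed to lie in S(Z). *)

theory Defs
  imports "HOL-Analysis.Analysis"
begin

text \<open>States and inputs live in \<open>real ^ 'n\<close> and \<open>real ^ 'm\<close>. Coordinates of \<open>mono1 z\<close> are
  indexed by \<open>('n + 'm) option\<close>, where \<open>None\<close> stands for the constant monomial.\<close>

type_synonym ('n, 'm) pair = "(real ^ 'n) \<times> (real ^ 'm)"
type_synonym ('n, 'm) idx = "('n + 'm) option"
type_synonym ('n, 'm) feat = "real ^ (('n, 'm) idx \<times> ('n, 'm) idx)"

definition mono1 :: "('n::finite, 'm::finite) pair \<Rightarrow> real ^ ('n, 'm) idx" where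
  "mono1 z = (\<chi> k. case k of None \<Rightarrow> 1 | Some (Inl i) \<Rightarrow> fst z $ i | Some (Inr j) \<Rightarrow> snd z $ j)"

definition outer :: "real ^ 'k \<Rightarrow> real ^ 'k ^ 'k::finite" where
  "outer v = (\<chi> i j. v $ i * v $ j)"

definition vectorize :: "real ^ 'k ^ 'k \<Rightarrow> real ^ ('k::finite \<times> 'k)" where
  "vectorize A = (\<chi> ij. A $ fst ij $ snd ij)"

definition matricize :: "real ^ ('k::finite \<times> 'k) \<Rightarrow> real ^ 'k ^ 'k" where
  "matricize a = (\<chi> i j. a $ (i, j))"

definition psd :: "real ^ 'k ^ 'k::finite \<Rightarrow> bool" where
  "psd A \<longleftrightarrow> transpose A = A \<and> (\<forall>v. 0 \<le> v \<bullet> (A *v v))"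

definition phi :: "('n::finite, 'm::finite) pair \<Rightarrow> ('n, 'm) feat" where
  "phi z = vectorize (outer (mono1 z))"

text \<open>Members of the following function spaces are total functions of which only the values on
  \<open>Z\<close> matter; \<open>Z\<close> carries the trace of the Borel \<open>\<sigma>\<close>-algebra.\<close>

definition weighted_space :: "'z::topological_space set \<Rightarrow> ('z \<Rightarrow> real) \<Rightarrow> ('z \<Rightarrow> real) set" where
  "weighted_space Z \<omega> =
     {q \<in> borel_measurable (restrict_space borel Z). bdd_above ((\<lambda>z. \<bar>q z\<bar> / \<omega> z) ` Z)}"

text \<open>For a nonnegative measure, the weighted total variation is the integral of the weight.\<close>

definition pos_measures :: "'z::topological_space set \<Rightarrow> ('z \<Rightarrow> real) \<Rightarrow> 'z measure set" where
  "pos_measures Z \<omega> =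
     {c. sets c = sets (restrict_space borel Z) \<and> finite_measure c \<and>
         (\<integral>\<^sup>+ z. ennreal (\<omega> z) \<partial>c) < \<infinity> \<and> 0 < emeasure c Z}"

definition S_quad ::
  "('n::finite, 'm::finite) pair set \<Rightarrow> (('n, 'm) pair \<Rightarrow> real) \<Rightarrow> (('n, 'm) pair \<Rightarrow> real) set" where
  "S_quad Z \<omega> =
     {q \<in> weighted_space Z \<omega>. \<exists>Q. transpose Q = Q \<and> (\<forall>z\<in>Z. q z = vectorize Q \<bullet> phi z)}"

definition Phi ::
  "real \<Rightarrow> ('N::finite \<Rightarrow> ('n::finite, 'm::finite) pair) \<Rightarrow> ('N \<Rightarrow> ('n, 'm) pair)
    \<Rightarrow> real ^ 'N ^ (('n, 'm) idx \<times> ('n, 'm) idx)" where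
  "Phi \<gamma> z zp = (\<chi> k i. phi (z i) $ k - \<gamma> * phi (zp i) $ k)"

definition cost_vector :: "('n::finite, 'm::finite) pair measure \<Rightarrow> ('n, 'm) feat" where
  "cost_vector c = (\<integral> z. phi z \<partial>c)"

definition lp_feasible ::
  "('n::finite, 'm::finite) pair set \<Rightarrow> (('n, 'm) pair \<Rightarrow> real)
    \<Rightarrow> real ^ 'N ^ (('n, 'm) idx \<times> ('n, 'm) idx) \<Rightarrow> real ^ 'N::finite \<Rightarrow> ('n, 'm) feat set" where
  "lp_feasible Z \<omega> \<Phi> l =
     {\<alpha>. (\<exists>Q. transpose Q = Q \<and> \<alpha> = vectorize Q) \<and> (\<lambda>z. \<alpha> \<bullet> phi z) \<in> S_quad Z \<omega> \<and>
         transpose \<Phi> *v \<alpha> \<le> l}"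

text \<open>The optimal value of the linear program with cost vector \<open>b\<close>: it is \<open>\<infinity>\<close> if the program is
  unbounded and \<open>-\<infinity>\<close> if it is infeasible.\<close>

definition lp_value ::
  "('n::finite, 'm::finite) pair set \<Rightarrow> (('n, 'm) pair \<Rightarrow> real)
    \<Rightarrow> real ^ 'N ^ (('n, 'm) idx \<times> ('n, 'm) idx) \<Rightarrow> real ^ 'N::finite \<Rightarrow> ('n, 'm) feat \<Rightarrow> ereal" where
  "lp_value Z \<omega> \<Phi> l b = (SUP \<alpha> \<in> lp_feasible Z \<omega> \<Phi> l. ereal (\<alpha> \<bullet> b))"

definition lp_finite ::
  "('n::finite, 'm::finite) pair set \<Rightarrow> (('n, 'm) pair \<Rightarrow> real)
    \<Rightarrow> real ^ 'N ^ (('n, 'm) idx \<times> ('n, 'm) idx) \<Rightarrow> real ^ 'N::finite \<Rightarrow> ('n, 'm) feat \<Rightarrow> bool" where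
  "lp_finite Z \<omega> \<Phi> l b \<longleftrightarrow> \<bar>lp_value Z \<omega> \<Phi> l b\<bar> \<noteq> \<infinity>"

lemma matricize_Phi:
  "matricize (Phi \<gamma> z zp *v lam) =
     (\<Sum>i\<in>UNIV. lam $ i *\<^sub>R (outer (mono1 (z i)) - \<gamma> *\<^sub>R outer (mono1 (zp i))))"
  by (simp add: vec_eq_iff matricize_def Phi_def phi_def vectorize_def matrix_vector_mult_def
      mult.commute)

lemma vectorize_inner_phi: "vectorize Q \<bullet> phi z = mono1 z \<bullet> (Q *v mono1 z)"
proof -
  have "vectorize Q \<bullet> phi z =
      (\<Sum>(i, j) \<in> UNIV \<times> UNIV. Q $ i $ j * (mono1 z $ i * mono1 z $ j))"
    by (simp add: inner_vec_def vectorize_def phi_def outer_def case_prod_beta)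
  also have "\<dots> = mono1 z \<bullet> (Q *v mono1 z)"
    unfolding sum.cartesian_product[symmetric]
    by (simp add: inner_vec_def matrix_vector_mult_def sum_distrib_left mult_ac)
  finally show ?thesis .
qed

end

theory Submission
  imports Defs
begin

text \<open>The zero vector is feasible because the stage cost is nonnegative. Hence the program is finite
  iff its objective \<open>b\<close> increases along no symmetric recession direction, and by Farkas' lemma this
  means \<open>b = \<Phi> \<lambda>\<close> with \<open>\<lambda> \<ge> 0\<close>. A cost vector given by a measure is a nonzero moment matrix, so it is
  positive semidefinite and \<open>\<lambda> \<noteq> 0\<close>. Conversely, weak duality bounds the program with cost vector
  \<open>\<Phi> \<lambda>\<close>. The constant monomial contributes the entry \<open>(1 - \<gamma>) \<Sum>\<lambda>\<^sub>i > 0\<close> to \<open>\<Phi> \<lambda>\<close>, and a positive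
  semidefinite matrix whose corner entry is positive is the moment matrix of finitely many atoms when
  the whole space is available.\<close>

section \<open>Farkas' lemma by separation from a finitely generated cone\<close>

text \<open>The cone generated by finitely many columns is closed, so a point \<open>b\<close>
  outside it is strictly separated from it by some normal \<open>a\<close>. Then \<open>- a\<close>
  is a ray with positive inner product with \<open>b\<close>, against \<open>no_ray\<close>.\<close>

lemma farkas:
  fixes A :: "real ^ 'n ^ 'm" and b :: "real ^ 'm"
  assumes no_ray: "\<And>d. transpose A *v d \<le> 0 \<Longrightarrow> d \<bullet> b \<le> 0"
  obtains lam where "0 \<le> lam" "A *v lam = b"
proof -
  let ?C = "{A *v lam |lam. 0 \<le> lam}" and ?H = "convex_cone hull (range (\<lambda>i. column i A))"
  have "convex_cone ?C"
    unfolding convex_cone_iff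
  proof (intro conjI ballI allI impI)
    show "0 \<in> ?C" by (auto intro!: exI[of _ 0])
  next
    fix x y assume "x \<in> ?C" "y \<in> ?C"
    then obtain p q where "x = A *v p" "0 \<le> p" "y = A *v q" "0 \<le> q" by blast
    then show "x + y \<in> ?C"
      by (auto intro!: exI[of _ "p + q"] simp: matrix_vector_right_distrib less_eq_vec_def)
  next
    fix x and t :: real assume "x \<in> ?C" "0 \<le> t"
    then obtain p where "x = A *v p" "0 \<le> p" by blast
    with \<open>0 \<le> t\<close> show "t *\<^sub>R x \<in> ?C"
      by (auto intro!: exI[of _ "t *\<^sub>R p"] simp: matrix_vector_mult_scaleR less_eq_vec_def)
  qed
  moreover have "range (\<lambda>i. column i A) \<subseteq> ?C"
  proof clarify
    fix i
    have "column i A = A *v axis i 1" "0 \<le> (axis i 1 :: real ^ 'n)"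
      by (simp_all only: matrix_vector_mult_basis) (simp add: less_eq_vec_def axis_def)
    then show "\<exists>lam. column i A = A *v lam \<and> 0 \<le> lam" by blast
  qed
  ultimately have HC: "?H \<subseteq> ?C" by (rule hull_minimal[rotated])
  have "b \<in> ?H"
  proof (rule ccontr)
    assume "b \<notin> ?H"
    then obtain a \<beta> where ab: "a \<bullet> b < \<beta>" and aH: "\<And>y. y \<in> ?H \<Longrightarrow> \<beta> < a \<bullet> y"
      using separating_hyperplane_closed_point[OF convex_convex_cone_hull closed_convex_cone_hull]
      by (metis finite finite_imageI)
    have "\<beta> < 0" using aH[OF convex_cone_hull_contains_0] by simp
    have col: "0 \<le> a \<bullet> column i A" for i
    proof (rule ccontr)
      assume neg: "\<not> 0 \<le> a \<bullet> column i A"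
      \<comment> \<open>Numerator and denominator are negative, so this is a nonnegative multiple of
        the column. Its inner product with \<open>a\<close> is exactly \<open>\<beta>\<close>, which
        strict separation forbids.\<close>
      then have "(\<beta> / (a \<bullet> column i A)) *\<^sub>R column i A \<in> ?H"
        using \<open>\<beta> < 0\<close>
        by (intro convex_cone_hull_mul hull_inc) (auto intro: divide_nonpos_nonpos)
      from aH[OF this] neg show False by simp
    qed
    have "transpose A *v (- a) \<le> 0"
      using col
      by (simp add: less_eq_vec_def matrix_vector_mult_def transpose_def column_def inner_vec_def
          sum_negf mult.commute)
    from no_ray[OF this] ab \<open>\<beta> < 0\<close> show False by simp
  qed
  with HC that show thesis by auto
qed

section \<open>Positive semidefinite matrices: Schur complements and rank-one sums\<close>

lemma symmetric_matrix_inner: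
  fixes A :: "real ^ 'k ^ 'k"
  assumes "transpose A = A"
  shows "x \<bullet> (A *v y) = (A *v x) \<bullet> y"
  by (metis assms dot_lmul_matrix transpose_matrix_vector)

lemma symmetric_matrix_entries:
  assumes "transpose A = A"
  shows "A $ i $ j = A $ j $ i"
proof -
  have "transpose A $ i $ j = A $ i $ j" by (simp only: assms)
  then show ?thesis by (simp add: transpose_def)
qed

lemma psd_diagonal_nonneg:
  assumes "psd A"
  shows "0 \<le> A $ i $ i"
proof -
  have "0 \<le> axis i 1 \<bullet> (A *v axis i 1)" using assms by (simp add: psd_def)
  then show ?thesis by (simp add: inner_axis' matrix_vector_mult_basis column_def)
qed

text \<open>With \<open>A $ i $ i = 0\<close> the quadratic form is affine in \<open>t\<close> along
  \<open>axis j 1 + t *\<^sub>R axis i 1\<close>. A nonzero slope would make it negative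
  somewhere.\<close>

lemma psd_zero_diagonal:
  assumes A: "psd A" and 0: "A $ i $ i = 0"
  shows "A $ i $ j = 0" and "A $ j $ i = 0"
proof -
  have sym: "A $ j $ i = A $ i $ j"
    using A by (simp add: psd_def symmetric_matrix_entries)
  have *: "0 \<le> A $ j $ j + 2 * t * A $ i $ j" for t
  proof -
    let ?v = "axis j 1 + t *\<^sub>R axis i 1 :: real ^ 'a"
    have "0 \<le> ?v \<bullet> (A *v ?v)" using A by (simp add: psd_def)
    also have "?v \<bullet> (A *v ?v) = A $ j $ j + 2 * t * A $ i $ j"
      by (simp add: matrix_vector_right_distrib matrix_vector_mult_scaleR inner_add_left
          inner_add_right inner_axis' matrix_vector_mult_basis column_def 0 sym algebra_simps)
    finally show ?thesis .
  qed
  show "A $ i $ j = 0"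
  proof (rule ccontr)
    assume "A $ i $ j \<noteq> 0"
    \<comment> \<open>At this \<open>t\<close> the form has the value -1.\<close>
    with *[of "- (A $ j $ j + 1) / (2 * A $ i $ j)"] show False by (simp add: field_simps)
  qed
  with sym show "A $ j $ i = 0" by simp
qed

lemma outer_mult_vec: "outer a *v v = (a \<bullet> v) *\<^sub>R a"
  by (simp add: vec_eq_iff outer_def matrix_vector_mult_def inner_vec_def sum_distrib_left mult_ac)

text \<open>Completing the square: at \<open>v\<close>, the form of the complement equals the form
  of \<open>A\<close> at \<open>v\<close> shifted along the pivot axis, which is
  nonnegative.\<close>

lemma psd_Schur_complement:
  assumes A: "psd A" and pos: "0 < A $ i $ i"
  shows "psd (A - (1 / A $ i $ i) *\<^sub>R outer (column i A))"
  unfolding psd_def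
proof (intro conjI allI)
  have sym: "transpose A = A" using A by (simp add: psd_def)
  then show "transpose (A - (1 / A $ i $ i) *\<^sub>R outer (column i A)) =
      A - (1 / A $ i $ i) *\<^sub>R outer (column i A)"
    by (simp add: vec_eq_iff transpose_def outer_def mult.commute)
  fix v
  \<comment> \<open>The minimizer of the form of \<open>A\<close> along the pivot axis through
    \<open>v\<close>.\<close>
  define t where "t = (column i A \<bullet> v) / A $ i $ i"
  let ?v = "v - t *\<^sub>R axis i 1"
  have "axis i 1 \<bullet> (A *v v) = column i A \<bullet> v"
    by (simp add: symmetric_matrix_inner[OF sym] matrix_vector_mult_basis)
  then have "?v \<bullet> (A *v ?v) = v \<bullet> (A *v v) - 2 * t * (column i A \<bullet> v) + t\<^sup>2 * A $ i $ i"
    by (simp add: matrix_vector_mult_diff_distrib matrix_vector_mult_scaleR inner_diff_left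
        inner_diff_right inner_axis' matrix_vector_mult_basis column_def inner_commute
        power2_eq_square algebra_simps)
  also have "\<dots> = v \<bullet> (A *v v) - (column i A \<bullet> v)\<^sup>2 / A $ i $ i"
    using pos by (simp add: t_def power2_eq_square)
  also have "\<dots> = v \<bullet> ((A - (1 / A $ i $ i) *\<^sub>R outer (column i A)) *v v)"
    by (simp add: matrix_vector_mult_diff_rdistrib scaleR_matrix_vector_assoc[symmetric]
        outer_mult_vec inner_diff_right inner_commute power2_eq_square)
  finally show "0 \<le> v \<bullet> ((A - (1 / A $ i $ i) *\<^sub>R outer (column i A)) *v v)"
    using A by (metis psd_def)
qed

lemma outer_scaleR: "outer (t *\<^sub>R v) = t\<^sup>2 *\<^sub>R outer v"
  by (simp add: vec_eq_iff outer_def power2_eq_square)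

text \<open>Cholesky-type elimination, one index of \<open>S\<close> at a time. The support
  condition on the \<open>v k\<close> later keeps the constant coordinate of the atoms equal to
  1.\<close>

lemma psd_sum_outer:
  fixes A :: "real ^ 'k ^ 'k"
  assumes "psd A" and "\<And>i j. i \<notin> S \<Longrightarrow> A $ i $ j = 0"
  obtains v where "A = (\<Sum>k\<in>S. outer (v k))" "\<And>k j. k \<in> S \<Longrightarrow> j \<notin> S \<Longrightarrow> v k $ j = 0"
proof -
  have "finite S" by simp
  then have "\<exists>v. A = (\<Sum>k\<in>S. outer (v k)) \<and> (\<forall>k\<in>S. \<forall>j. j \<notin> S \<longrightarrow> v k $ j = 0)"
    using assms
  proof (induction S arbitrary: A)
    case empty
    then show ?case by (simp add: vec_eq_iff)
  next
    case (insert i S)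
    have sym: "A $ p $ q = A $ q $ p" for p q
      using \<open>psd A\<close> unfolding psd_def by (blast intro: symmetric_matrix_entries)
    show ?case
    proof (cases "A $ i $ i = 0")
      case True
      \<comment> \<open>A zero pivot forces its whole row to vanish, so \<open>i\<close> contributes
        the zero vector.\<close>
      then have "A $ p $ q = 0" if "p \<notin> S" for p q
        using insert.prems psd_zero_diagonal[OF \<open>psd A\<close> True] that by (cases "p = i") auto
      with insert.IH[OF \<open>psd A\<close>] obtain v where
        "A = (\<Sum>k\<in>S. outer (v k))" "\<forall>k\<in>S. \<forall>j. j \<notin> S \<longrightarrow> v k $ j = 0"
        by blast
      moreover have "outer (0 :: real ^ 'k) = 0" by (simp add: vec_eq_iff outer_def)
      ultimately show ?thesis
        using insert.hyps by (intro exI[of _ "v(i := 0)"]) (auto intro!: sum.cong simp: fun_upd_def)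
    next
      case False
      then have pos: "0 < A $ i $ i" using psd_diagonal_nonneg[OF \<open>psd A\<close>, of i] by simp
      let ?B = "A - (1 / A $ i $ i) *\<^sub>R outer (column i A)"
      \<comment> \<open>The pivot clears row \<open>i\<close>. Rows outside
        \<open>insert i S\<close> vanish in \<open>A\<close> and, through
        \<open>A $ p $ i = 0\<close>, in the subtracted term as well.\<close>
      have "?B $ p $ q = 0" if "p \<notin> S" for p q
        using insert.prems(2)[of p q] insert.prems(2)[of p i] that pos
        by (cases "p = i") (auto simp: outer_def column_def sym)
      with insert.IH[OF psd_Schur_complement[OF \<open>psd A\<close> pos]] obtain v where
        v: "?B = (\<Sum>k\<in>S. outer (v k))" "\<forall>k\<in>S. \<forall>j. j \<notin> S \<longrightarrow> v k $ j = 0"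
        by blast
      let ?v = "v(i := (1 / sqrt (A $ i $ i)) *\<^sub>R column i A)"
      have "outer (?v i) = (1 / A $ i $ i) *\<^sub>R outer (column i A)"
        using pos by (simp add: outer_scaleR power_divide)
      moreover have "(\<Sum>k\<in>S. outer (?v k)) = (\<Sum>k\<in>S. outer (v k))"
        using insert.hyps by (intro sum.cong) auto
      ultimately have "(\<Sum>k\<in>insert i S. outer (?v k)) =
          (1 / A $ i $ i) *\<^sub>R outer (column i A) + ?B"
        unfolding v(1) using insert.hyps by simp
      then have "A = (\<Sum>k\<in>insert i S. outer (?v k))" by simp
      moreover have "\<forall>k\<in>insert i S. \<forall>j. j \<notin> insert i S \<longrightarrow> ?v k $ j = 0"
        using v(2) insert.prems(2) by (auto simp: column_def)
      ultimately show ?thesis by blast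
    qed
  qed
  with that show thesis by blast
qed

section \<open>The linear program: feasible set, weak duality, recession directions\<close>

lemma inner_phi_weighted_space:
  fixes \<omega> :: "('n::finite, 'm::finite) pair \<Rightarrow> real"
  assumes pos: "\<And>y. y \<in> Z \<Longrightarrow> 0 < \<omega> y"
    and features: "\<And>k. (\<lambda>y. phi y $ k) \<in> weighted_space Z \<omega>"
  shows "(\<lambda>y. \<alpha> \<bullet> phi y) \<in> weighted_space Z \<omega>"
proof -
  have "\<exists>B. \<forall>y\<in>Z. \<bar>phi y $ k\<bar> / \<omega> y \<le> B" for k
    using features[of k] by (auto simp: weighted_space_def bdd_above_def)
  then obtain B where B: "\<And>k y. y \<in> Z \<Longrightarrow> \<bar>phi y $ k\<bar> / \<omega> y \<le> B k" by metis
  have "\<bar>\<alpha> \<bullet> phi y\<bar> / \<omega> y \<le> (\<Sum>k\<in>UNIV. \<bar>\<alpha> $ k\<bar> * B k)" if "y \<in> Z" for y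
  proof -
    have "\<bar>\<alpha> \<bullet> phi y\<bar> / \<omega> y \<le> (\<Sum>k\<in>UNIV. \<bar>\<alpha> $ k * phi y $ k\<bar>) / \<omega> y"
      using pos[OF that] by (intro divide_right_mono) (simp_all add: inner_vec_def)
    also have "\<dots> = (\<Sum>k\<in>UNIV. \<bar>\<alpha> $ k\<bar> * (\<bar>phi y $ k\<bar> / \<omega> y))"
      by (simp add: sum_divide_distrib abs_mult)
    also have "\<dots> \<le> (\<Sum>k\<in>UNIV. \<bar>\<alpha> $ k\<bar> * B k)"
      by (intro sum_mono mult_left_mono B that) simp
    finally show ?thesis .
  qed
  then have "bdd_above ((\<lambda>y. \<bar>\<alpha> \<bullet> phi y\<bar> / \<omega> y) ` Z)" by (rule bdd_aboveI2)
  moreover have "(\<lambda>y. \<alpha> \<bullet> phi y) \<in> borel_measurable (restrict_space borel Z)"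
    using features unfolding inner_vec_def weighted_space_def
    by (auto intro!: borel_measurable_sum borel_measurable_times)
  ultimately show ?thesis by (simp add: weighted_space_def)
qed

text \<open>Describes the feasible set as a polyhedron in coefficient space; the weighted bounds on
  the features supply membership in \<open>S_quad\<close>.\<close>

lemma lp_feasible_iff:
  fixes \<omega> :: "('n::finite, 'm::finite) pair \<Rightarrow> real"
  assumes "\<And>y. y \<in> Z \<Longrightarrow> 0 < \<omega> y"
    and "\<And>k. (\<lambda>y. phi y $ k) \<in> weighted_space Z \<omega>"
  shows "\<alpha> \<in> lp_feasible Z \<omega> \<Phi> l \<longleftrightarrow>
    (\<forall>i j. \<alpha> $ (i, j) = \<alpha> $ (j, i)) \<and> transpose \<Phi> *v \<alpha> \<le> l"
proof -
  have "(\<exists>Q. transpose Q = Q \<and> \<alpha> = vectorize Q) \<longleftrightarrow> (\<forall>i j. \<alpha> $ (i, j) = \<alpha> $ (j, i))"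
  proof
    assume "\<forall>i j. \<alpha> $ (i, j) = \<alpha> $ (j, i)"
    then show "\<exists>Q. transpose Q = Q \<and> \<alpha> = vectorize Q"
      by (intro exI[of _ "matricize \<alpha>"])
        (simp add: vec_eq_iff transpose_def matricize_def vectorize_def)
  next
    assume "\<exists>Q. transpose Q = Q \<and> \<alpha> = vectorize Q"
    then obtain Q where "transpose Q = Q" "\<alpha> = vectorize Q" by blast
    then show "\<forall>i j. \<alpha> $ (i, j) = \<alpha> $ (j, i)"
      by (auto simp: vectorize_def intro: symmetric_matrix_entries)
  qed
  then show ?thesis
    using inner_phi_weighted_space[OF assms, of \<alpha>] by (auto simp: lp_feasible_def S_quad_def)
qed

lemma inner_matrix_vector_le:
  fixes A :: "real ^ 'n ^ 'm"
  assumes "0 \<le> lam" "transpose A *v \<alpha> \<le> l"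
  shows "\<alpha> \<bullet> (A *v lam) \<le> l \<bullet> lam"
proof -
  have "\<alpha> \<bullet> (A *v lam) = (transpose A *v \<alpha>) \<bullet> lam"
    by (metis dot_lmul_matrix transpose_matrix_vector)
  also have "\<dots> \<le> l \<bullet> lam"
    unfolding inner_vec_def using assms
    by (intro sum_mono) (auto simp: less_eq_vec_def intro: mult_right_mono)
  finally show ?thesis .
qed

text \<open>The value is trapped between the objective 0 at the zero vector and the weak duality
  bound \<open>l \<bullet> lam\<close>.\<close>

lemma lp_finite_dual_feasible:
  fixes \<omega> :: "('n::finite, 'm::finite) pair \<Rightarrow> real"
  assumes "\<And>y. y \<in> Z \<Longrightarrow> 0 < \<omega> y"
    and "\<And>k. (\<lambda>y. phi y $ k) \<in> weighted_space Z \<omega>"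
    and "0 \<le> l" and "0 \<le> lam"
  shows "lp_finite Z \<omega> \<Phi> l (\<Phi> *v lam)"
proof -
  note feas = lp_feasible_iff[OF assms(1,2)]
  have "0 \<in> lp_feasible Z \<omega> \<Phi> l" using \<open>0 \<le> l\<close> by (simp add: feas)
  then have "ereal 0 \<le> lp_value Z \<omega> \<Phi> l (\<Phi> *v lam)"
    unfolding lp_value_def by (rule SUP_upper2) simp
  moreover have "lp_value Z \<omega> \<Phi> l (\<Phi> *v lam) \<le> ereal (l \<bullet> lam)"
    unfolding lp_value_def
    by (rule SUP_least) (simp add: feas inner_matrix_vector_le[OF \<open>0 \<le> lam\<close>])
  ultimately show ?thesis unfolding lp_finite_def
    by (cases "lp_value Z \<omega> \<Phi> l (\<Phi> *v lam)") auto
qed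

text \<open>Since \<open>0 \<le> l\<close>, all nonnegative multiples of \<open>d\<close> are
  feasible, so a positive \<open>d \<bullet> b\<close> would make the objective unbounded.\<close>

lemma lp_finite_no_ray:
  fixes \<omega> :: "('n::finite, 'm::finite) pair \<Rightarrow> real"
  assumes "\<And>y. y \<in> Z \<Longrightarrow> 0 < \<omega> y"
    and "\<And>k. (\<lambda>y. phi y $ k) \<in> weighted_space Z \<omega>"
    and "0 \<le> l" and fin: "lp_finite Z \<omega> \<Phi> l b"
    and sym: "\<And>i j. d $ (i, j) = d $ (j, i)" and d: "transpose \<Phi> *v d \<le> 0"
  shows "d \<bullet> b \<le> 0"
proof (rule ccontr)
  assume "\<not> d \<bullet> b \<le> 0"
  obtain r where r: "lp_value Z \<omega> \<Phi> l b = ereal r"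
    using fin by (cases "lp_value Z \<omega> \<Phi> l b") (auto simp: lp_finite_def)
  \<comment> \<open>Chosen so that the objective at \<open>t *\<^sub>R d\<close> is
    \<open>\<bar>r\<bar> + 1\<close>, above the supposed value \<open>r\<close>.\<close>
  define t where "t = (\<bar>r\<bar> + 1) / (d \<bullet> b)"
  have "0 \<le> t" using \<open>\<not> d \<bullet> b \<le> 0\<close> by (simp add: t_def)
  have "(transpose \<Phi> *v (t *\<^sub>R d)) $ i \<le> l $ i" for i
    using mult_nonneg_nonpos[OF \<open>0 \<le> t\<close>, of "(transpose \<Phi> *v d) $ i"] d \<open>0 \<le> l\<close>
    by (auto simp: matrix_vector_mult_scaleR less_eq_vec_def intro: order_trans)
  then have "t *\<^sub>R d \<in> lp_feasible Z \<omega> \<Phi> l"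
    using sym by (simp add: lp_feasible_iff[OF assms(1,2)] less_eq_vec_def)
  then have "ereal ((t *\<^sub>R d) \<bullet> b) \<le> lp_value Z \<omega> \<Phi> l b"
    unfolding lp_value_def by (rule SUP_upper)
  with r \<open>\<not> d \<bullet> b \<le> 0\<close> show False by (simp add: t_def)
qed

section \<open>Symmetrization and the cone generated by the data\<close>

lemma sum_swap_index:
  fixes g :: "'k::finite \<times> 'k \<Rightarrow> real"
  shows "(\<Sum>k\<in>UNIV. g (prod.swap k)) = (\<Sum>k\<in>UNIV. g k)"
  by (rule sum.reindex_bij_betw[OF bij_swap])

text \<open>Swapping the index pair permutes the summands, so pairing with a symmetric vector sees
  only the symmetric part of \<open>d\<close>.\<close>

lemma inner_symmetrize:
  fixes d c :: "real ^ ('k::finite \<times> 'k)"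
  assumes "\<And>i j. c $ (i, j) = c $ (j, i)"
  shows "(\<chi> k. (d $ k + d $ prod.swap k) / 2) \<bullet> c = d \<bullet> c"
proof -
  have c: "c $ prod.swap k = c $ k" for k using assms by (cases k) simp
  have "(\<chi> k. (d $ k + d $ prod.swap k) / 2) \<bullet> c =
      ((\<Sum>k\<in>UNIV. d $ k * c $ k) + (\<Sum>k\<in>UNIV. d $ prod.swap k * c $ prod.swap k)) / 2"
    by (simp add: inner_vec_def c algebra_simps add_divide_distrib sum.distrib
        flip: sum_divide_distrib)
  also have "\<dots> = d \<bullet> c"
    by (subst sum_swap_index) (simp add: inner_vec_def)
  finally show ?thesis .
qed

lemma phi_entry: "phi y $ (i, j) = mono1 y $ i * mono1 y $ j"
  by (simp add: phi_def vectorize_def outer_def)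

lemma phi_symmetric: "phi y $ (i, j) = phi y $ (j, i)"
  by (simp add: phi_entry mult.commute)

text \<open>Farkas' lemma tests all directions, but the program only admits symmetric ones. The
  columns of \<open>Phi \<gamma> z zp\<close> and \<open>b\<close> are symmetric, so replacing a
  direction by its symmetric part changes neither the constraints nor the objective.\<close>

lemma lp_finite_imp_cone:
  fixes \<omega> :: "('n::finite, 'm::finite) pair \<Rightarrow> real"
  assumes "\<And>y. y \<in> Z \<Longrightarrow> 0 < \<omega> y"
    and "\<And>k. (\<lambda>y. phi y $ k) \<in> weighted_space Z \<omega>"
    and "0 \<le> l" and "lp_finite Z \<omega> (Phi \<gamma> z zp) l b"
    and b: "\<And>i j. b $ (i, j) = b $ (j, i)"
  obtains lam where "0 \<le> lam" "Phi \<gamma> z zp *v lam = b"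
proof (rule farkas)
  fix d :: "('n, 'm) feat"
  assume d: "transpose (Phi \<gamma> z zp) *v d \<le> 0"
  let ?s = "\<chi> k. (d $ k + d $ prod.swap k) / 2"
  have entry: "(transpose (Phi \<gamma> z zp) *v e) $ i = e \<bullet> (phi (z i) - \<gamma> *\<^sub>R phi (zp i))" for e i
    by (simp add: matrix_vector_mult_def transpose_def Phi_def inner_vec_def mult.commute)
  have "?s \<bullet> (phi (z i) - \<gamma> *\<^sub>R phi (zp i)) = d \<bullet> (phi (z i) - \<gamma> *\<^sub>R phi (zp i))" for i
    by (rule inner_symmetrize) (simp add: phi_symmetric)
  then have "transpose (Phi \<gamma> z zp) *v ?s = transpose (Phi \<gamma> z zp) *v d"
    unfolding vec_eq_iff entry by blast
  with d have "?s \<bullet> b \<le> 0"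
    by (intro lp_finite_no_ray[OF assms(1-4)]) (simp_all add: add.commute)
  then show "d \<bullet> b \<le> 0" by (simp add: inner_symmetrize[OF b])
qed (rule that)

section \<open>Moment matrices of measures\<close>

text \<open>Reduces measurability and integrability of the vector-valued \<open>phi\<close> to its
  coordinates.\<close>

lemma phi_axis_sum: "phi y = (\<Sum>k\<in>UNIV. phi y $ k *\<^sub>R axis k 1)"
  using basis_expansion[of "phi y"] by (simp add: scalar_mult_eq_scaleR)

text \<open>Every coordinate is dominated by a multiple of \<open>\<omega>\<close>, which is
  integrable because the weighted total variation of \<open>c\<close> is finite.\<close>

lemma integrable_phi:
  fixes \<omega> :: "('n::finite, 'm::finite) pair \<Rightarrow> real"
  assumes weight: "\<omega> \<in> borel_measurable (restrict_space borel Z)" "\<And>y. y \<in> Z \<Longrightarrow> 0 < \<omega> y"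
    and features: "\<And>k. (\<lambda>y. phi y $ k) \<in> weighted_space Z \<omega>"
    and c: "c \<in> pos_measures Z \<omega>"
  shows "integrable c phi"
proof -
  have sets: "sets c = sets (restrict_space borel Z)" using c by (simp add: pos_measures_def)
  then have space: "space c = Z" using sets_eq_imp_space_eq[OF sets] by (simp add: space_restrict_space)
  have meas: "measurable c borel = measurable (restrict_space borel Z) (borel :: real measure)"
    by (rule measurable_cong_sets[OF sets refl])
  have nn: "AE y in c. 0 \<le> \<omega> y" using weight(2) by (intro AE_I2) (simp add: space less_imp_le)
  have w: "integrable c \<omega>"
    using c weight(1) by (intro integrableI_nonneg nn) (auto simp: meas pos_measures_def)
  have "integrable c (\<lambda>y. phi y $ k)" for k
  proof -
    obtain B where B: "\<And>y. y \<in> Z \<Longrightarrow> \<bar>phi y $ k\<bar> / \<omega> y \<le> B"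
      using features[of k] by (auto simp: weighted_space_def bdd_above_def)
    have "\<bar>phi y $ k\<bar> \<le> \<bar>B * \<omega> y\<bar>" if "y \<in> Z" for y
      using B[OF that] weight(2)[OF that] by (simp add: pos_divide_le_eq)
    then show ?thesis
      using features[of k]
      by (intro Bochner_Integration.integrable_bound[OF integrable_mult_right[OF w, of B]] AE_I2)
        (auto simp: meas space weighted_space_def)
  qed
  then show ?thesis
    by (subst phi_axis_sum[abs_def]) (intro Bochner_Integration.integrable_sum integrable_scaleR_left)
qed

text \<open>The quadratic form at \<open>v\<close> is the integral of the square of
  \<open>mono1 y \<bullet> v\<close>.\<close>

lemma psd_cost_vector:
  fixes c :: "('n::finite, 'm::finite) pair measure"
  assumes int: "integrable c phi"
  shows "psd (matricize (cost_vector c))"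
proof -
  have entry: "cost_vector c $ k = (\<integral>y. phi y $ k \<partial>c)" for k :: "('n, 'm) idx \<times> ('n, 'm) idx"
    using integral_inner_right[OF int, of "axis k 1"] by (simp add: cost_vector_def inner_axis')
  have "transpose (matricize (cost_vector c)) = matricize (cost_vector c)"
    by (simp add: vec_eq_iff transpose_def matricize_def entry phi_symmetric)
  moreover have "0 \<le> v \<bullet> (matricize (cost_vector c) *v v)" for v
  proof -
    \<comment> \<open>Written as an inner product with \<open>a\<close>, the form is visibly linear
      in the matrix and can be moved inside the integral.\<close>
    have quad: "v \<bullet> (matricize a *v v) = vectorize (outer v) \<bullet> a" for a
    proof -
      have "v \<bullet> (matricize a *v v) = (\<Sum>(i, j)\<in>UNIV \<times> UNIV. v $ i * v $ j * a $ (i, j))"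
        unfolding sum.cartesian_product[symmetric]
        by (simp add: inner_vec_def matricize_def matrix_vector_mult_def sum_distrib_left mult_ac)
      then show ?thesis by (simp add: inner_vec_def vectorize_def outer_def case_prod_beta)
    qed
    have "v \<bullet> (matricize (phi y) *v v) = (mono1 y \<bullet> v)\<^sup>2" for y
    proof -
      have "matricize (phi y) = outer (mono1 y)"
        by (simp add: vec_eq_iff matricize_def phi_entry outer_def)
      then show ?thesis by (simp add: outer_mult_vec inner_commute power2_eq_square)
    qed
    then have "v \<bullet> (matricize (cost_vector c) *v v) = (\<integral>y. (mono1 y \<bullet> v)\<^sup>2 \<partial>c)"
      unfolding quad cost_vector_def by (simp flip: integral_inner_right[OF int])
    then show ?thesis by simp
  qed
  ultimately show ?thesis by (simp add: psd_def)
qed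

text \<open>The entry of the constant monomial is the total mass of \<open>c\<close>.\<close>

lemma cost_vector_nonzero:
  assumes int: "integrable c phi" and c: "c \<in> pos_measures Z \<omega>"
  shows "cost_vector c \<noteq> 0"
proof -
  interpret finite_measure c using c by (simp add: pos_measures_def)
  have sets: "sets c = sets (restrict_space borel Z)" using c by (simp add: pos_measures_def)
  have space: "space c = Z" using sets_eq_imp_space_eq[OF sets] by (simp add: space_restrict_space)
  have "cost_vector c $ (None, None) = (\<integral>y. phi y $ (None, None) \<partial>c)"
    using integral_inner_right[OF int, of "axis (None, None) 1"]
    by (simp add: cost_vector_def inner_axis')
  also have "\<dots> = measure c Z" by (simp add: phi_entry mono1_def space)
  also have "\<dots> > 0" using c by (simp add: pos_measures_def emeasure_eq_measure)
  finally show ?thesis by auto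
qed

section \<open>Realizing positive semidefinite matrices by finitely many atoms\<close>

text \<open>A uniform point measure on the index set is pushed forward along \<open>g\<close>.
  Indexing the atoms lets points coincide, in which case their masses add.\<close>

lemma atomic_measure:
  fixes \<omega> :: "('n::finite, 'm::finite) pair \<Rightarrow> real" and g :: "'i \<Rightarrow> ('n, 'm) pair"
  assumes weight: "\<omega> \<in> borel_measurable borel"
    and features: "\<And>k. (\<lambda>y. phi y $ k) \<in> weighted_space UNIV \<omega>"
    and I: "finite I" "I \<noteq> {}" and r: "0 < r"
  obtains c where "c \<in> pos_measures UNIV \<omega>" "cost_vector c = (\<Sum>i\<in>I. r *\<^sub>R phi (g i))"
proof
  let ?p = "point_measure I (\<lambda>_. ennreal r)"
  let ?c = "distr ?p borel g"
  have g: "g \<in> measurable ?p borel" by simp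
  have "(\<lambda>y :: ('n, 'm) pair. phi y $ k) \<in> borel_measurable borel" for k
    using features[of k] measurable_cong_sets[OF sets_restrict_UNIV refl]
    by (auto simp: weighted_space_def)
  then have phi: "(phi :: ('n, 'm) pair \<Rightarrow> _) \<in> borel_measurable borel"
    by (subst phi_axis_sum[abs_def]) (auto intro!: borel_measurable_sum borel_measurable_scaleR)
  show "cost_vector ?c = (\<Sum>i\<in>I. r *\<^sub>R phi (g i))"
    using I r unfolding cost_vector_def
    by (simp add: integral_distr[OF g phi] lebesgue_integral_point_measure_finite)
  have total: "emeasure ?c UNIV = ennreal (card I * r)"
    using I r by (simp add: emeasure_distr[OF g] emeasure_point_measure_finite space_point_measure
        ennreal_mult ennreal_of_nat_eq_real_of_nat)
  have "(\<integral>\<^sup>+ y. ennreal (\<omega> y) \<partial>?c) < \<infinity>"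
    using I r weight
    by (simp add: nn_integral_distr[OF g] nn_integral_point_measure_finite ennreal_mult_less_top)
  moreover have "finite_measure ?c"
    by (rule finite_measureI) (simp add: total)
  ultimately show "?c \<in> pos_measures UNIV \<omega>"
    using I r by (simp add: pos_measures_def total card_gt_0_iff)
qed

text \<open>The point where the whole space is used: states and inputs are unrestricted, so atoms
  may be prescribed through their monomial vectors.\<close>

lemma mono1_surj:
  assumes "v $ None = 1"
  obtains y where "mono1 y = v"
proof
  show "mono1 (\<chi> i. v $ Some (Inl i), \<chi> j. v $ Some (Inr j)) = v"
    using assms by (auto simp: mono1_def vec_eq_iff split: option.split sum.split)
qed

lemma outer_plus_minus: "outer (a + b) + outer (a - b) = 2 *\<^sub>R outer a + 2 *\<^sub>R outer b"
  by (simp add: vec_eq_iff outer_def algebra_simps)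

text \<open>Each rank-one term \<open>d d\<^sup>T\<close> of the Schur complement of the constant monomial is realised by two
  atoms placed symmetrically about the mean \<open>\<mu>\<close>, so that the cross terms cancel.\<close>

lemma psd_moment_matrix:
  fixes \<omega> :: "('n::finite, 'm::finite) pair \<Rightarrow> real" and b :: "('n, 'm) feat"
  assumes weight: "\<omega> \<in> borel_measurable borel"
    and features: "\<And>k. (\<lambda>y. phi y $ k) \<in> weighted_space UNIV \<omega>"
    and b: "psd (matricize b)" and pos: "0 < b $ (None, None)"
  obtains c where "c \<in> pos_measures UNIV \<omega>" "cost_vector c = b"
proof -
  let ?M = "matricize b"
  define a where "a = b $ (None, None)"
  define S where "S = - {None :: ('n, 'm) idx}"
  define K where "K = real (card S)"
  have "0 < a" using pos by (simp add: a_def)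
  have M00: "?M $ None $ None = a" by (simp add: matricize_def a_def)
  have "S \<noteq> {}" by (auto simp: S_def)
  then have "0 < K" by (simp add: K_def card_gt_0_iff)
  \<comment> \<open>The monomial vector of the mean of a measure of total mass \<open>a\<close> with
    moment matrix \<open>?M\<close>.\<close>
  define \<mu> where "\<mu> = (1 / a) *\<^sub>R column None ?M"
  have \<mu>0: "\<mu> $ None = 1" using \<open>0 < a\<close> M00 by (simp add: \<mu>_def column_def)
  have sym: "?M $ i $ j = ?M $ j $ i" for i j
    using b unfolding psd_def by (blast intro: symmetric_matrix_entries)
  let ?B = "?M - (1 / ?M $ None $ None) *\<^sub>R outer (column None ?M)"
  have "psd ?B" using psd_Schur_complement[OF b] \<open>0 < a\<close> M00 by metis
  \<comment> \<open>The pivot clears row \<open>None\<close>, so the vectors \<open>d k\<close>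
    obtained below have constant coordinate 0.\<close>
  moreover have "?B $ i $ j = 0" if "i \<notin> S" for i j
    using that \<open>0 < a\<close> sym[of None j] by (simp add: S_def M00 outer_def column_def)
  ultimately obtain d where d: "?B = (\<Sum>k\<in>S. outer (d k))"
    and d0: "\<And>k j. k \<in> S \<Longrightarrow> j \<notin> S \<Longrightarrow> d k $ j = 0"
    using psd_sum_outer by blast
  have outer_\<mu>: "(1 / a) *\<^sub>R outer (column None ?M) = a *\<^sub>R outer \<mu>"
    using \<open>0 < a\<close> by (simp add: \<mu>_def outer_scaleR power2_eq_square)
  have M: "?M = a *\<^sub>R outer \<mu> + (\<Sum>k\<in>S. outer (d k))"
    by (simp flip: d add: M00 outer_\<mu>)
  \<comment> \<open>There are \<open>2 * K\<close> atoms of mass \<open>a / (2 * K)\<close>, so the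
    total mass is \<open>a\<close>. A pair contributes \<open>a / K\<close> times the outer product
    of \<open>e k\<close>, and the factor \<open>sqrt (K / a)\<close> turns this into
    \<open>outer (d k)\<close>.\<close>
  define e where "e k = sqrt (K / a) *\<^sub>R d k" for k
  have "\<exists>y. mono1 y = \<mu> + snd p *\<^sub>R e (fst p)" if "p \<in> S \<times> UNIV" for p
  proof (rule mono1_surj)
    show "(\<mu> + snd p *\<^sub>R e (fst p)) $ None = 1"
      using \<mu>0 d0[of "fst p" None] that by (auto simp: S_def e_def)
  qed blast
  then obtain g where "\<forall>p\<in>S \<times> UNIV. mono1 (g p) = \<mu> + snd p *\<^sub>R e (fst p)"
    by (metis bchoice)
  then have g: "mono1 (g (k, s)) = \<mu> + s *\<^sub>R e k" if "k \<in> S" for k s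
    using that by simp
  let ?I = "S \<times> {1, -1 :: real}"
  obtain c where c: "c \<in> pos_measures UNIV \<omega>"
    "cost_vector c = (\<Sum>i\<in>?I. (a / (2 * K)) *\<^sub>R phi (g i))"
    using atomic_measure[OF weight features, of ?I "a / (2 * K)" g] \<open>S \<noteq> {}\<close> \<open>0 < a\<close> \<open>0 < K\<close>
    by auto
  have "(\<Sum>i\<in>?I. (a / (2 * K)) *\<^sub>R outer (mono1 (g i))) =
      (\<Sum>k\<in>S. (a / (2 * K)) *\<^sub>R (outer (\<mu> + e k) + outer (\<mu> - e k)))"
    by (simp add: sum.cartesian_product' g scaleR_right_distrib)
  also have "\<dots> = (\<Sum>k\<in>S. (a / K) *\<^sub>R outer \<mu> + outer (d k))"
    using \<open>0 < a\<close> \<open>0 < K\<close>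
    by (simp add: outer_plus_minus e_def outer_scaleR scaleR_right_distrib)
  also have "\<dots> = ?M"
    using \<open>S \<noteq> {}\<close> by (simp add: M sum.distrib sum_constant_scaleR K_def del: sum_constant)
  finally have "(\<Sum>i\<in>?I. (a / (2 * K)) *\<^sub>R outer (mono1 (g i))) = ?M" .
  then have "(\<Sum>i\<in>?I. (a / (2 * K)) *\<^sub>R outer (mono1 (g i))) $ i $ j = ?M $ i $ j" for i j
    by simp
  then have "cost_vector c = b"
    by (simp add: c(2) vec_eq_iff phi_entry outer_def matricize_def)
  with c(1) that show thesis by blast
qed

text \<open>Finiteness is claimed for some measure, since for a fixed one it means that its cost
  vector lies in the cone of the data. On a proper subset \<open>Z\<close>, a positive semidefinite
  \<open>matricize (\<Phi> *v lam)\<close> need not be the moment matrix of a measure on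
  \<open>Z\<close>: constant dynamics 1/2 on [0,1], with data at 0 and 1 equally weighted and
  \<open>\<gamma>\<close> near 1, give a normalized second moment above 1. Realization by a measure
  is therefore claimed for the whole space.\<close>

theorem proposition2:
  fixes X :: "(real ^ 'n::finite) set" and U :: "(real ^ 'm::finite) set"
    and f :: "(real ^ 'n) \<times> (real ^ 'm) \<Rightarrow> real ^ 'n"
    and ell :: "(real ^ 'n) \<times> (real ^ 'm) \<Rightarrow> real"
    and \<omega> :: "(real ^ 'n) \<times> (real ^ 'm) \<Rightarrow> real"
    and \<gamma> :: real
    and x xp :: "'N::finite \<Rightarrow> real ^ 'n" and u w :: "'N \<Rightarrow> real ^ 'm"
    and z zp :: "'N \<Rightarrow> (real ^ 'n) \<times> (real ^ 'm)"
    and l :: "real ^ 'N"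
    and Z :: "((real ^ 'n) \<times> (real ^ 'm)) set"
    and \<Phi> :: "real ^ 'N ^ (('n, 'm) idx \<times> ('n, 'm) idx)"
  assumes Z: "Z = X \<times> U"
    and f: "f \<in> X \<times> U \<rightarrow> X"
    and ell: "ell \<in> X \<times> U \<rightarrow> {0..}"
    and \<gamma>: "0 < \<gamma>" "\<gamma> < 1"
    and weight: "\<omega> \<in> borel_measurable (restrict_space borel Z)" "\<And>y. y \<in> Z \<Longrightarrow> 0 < \<omega> y"
    and features: "\<And>k. (\<lambda>y. phi y $ k) \<in> weighted_space Z \<omega>"
    and z: "\<And>i. z i = (x i, u i)" "\<And>i. z i \<in> Z"
    and xp: "\<And>i. xp i = f (x i, u i)"
    and w: "\<And>i. w i \<in> U"
    and zp: "\<And>i. zp i = (xp i, w i)"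
    and l: "l = (\<chi> i. ell (z i))"
    and \<Phi>: "\<Phi> = Phi \<gamma> z zp"
  shows
    "((\<exists>c\<in>pos_measures Z \<omega>. lp_finite Z \<omega> \<Phi> l (cost_vector c)) \<longrightarrow>
        (\<exists>lam. 0 \<le> lam \<and> lam \<noteq> 0 \<and> psd (matricize (\<Phi> *v lam)))) \<and>
     (\<forall>lam. 0 \<le> lam \<and> lam \<noteq> 0 \<and> psd (matricize (\<Phi> *v lam)) \<longrightarrow>
        lp_finite Z \<omega> \<Phi> l (\<Phi> *v lam)) \<and>
     (X = UNIV \<and> U = UNIV \<longrightarrow>
        ((\<exists>c\<in>pos_measures Z \<omega>. lp_finite Z \<omega> \<Phi> l (cost_vector c)) \<longleftrightarrow>
           (\<exists>lam. 0 \<le> lam \<and> lam \<noteq> 0 \<and> psd (matricize (\<Phi> *v lam)))) \<and>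
        (\<forall>lam. 0 \<le> lam \<and> lam \<noteq> 0 \<and> psd (matricize (\<Phi> *v lam)) \<longrightarrow>
           (\<exists>c\<in>pos_measures Z \<omega>. cost_vector c = \<Phi> *v lam)))"
proof -
  have l0: "0 \<le> l" using ell z(2) by (auto simp: l less_eq_vec_def Z)
  have necessary: "\<exists>lam. 0 \<le> lam \<and> lam \<noteq> 0 \<and> psd (matricize (\<Phi> *v lam))"
    if c: "c \<in> pos_measures Z \<omega>" and fin: "lp_finite Z \<omega> \<Phi> l (cost_vector c)" for c
  proof -
    have int: "integrable c phi" by (rule integrable_phi[OF weight features c])
    have psd: "psd (matricize (cost_vector c))" by (rule psd_cost_vector[OF int])
    \<comment> \<open>The symmetry of the cost vector is what allows symmetrized directions in the
      cone argument.\<close>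
    then have "cost_vector c $ (i, j) = cost_vector c $ (j, i)" for i j
      using symmetric_matrix_entries[of "matricize (cost_vector c)" i j]
      by (simp add: psd_def matricize_def)
    then obtain lam where lam: "0 \<le> lam" "\<Phi> *v lam = cost_vector c"
      using lp_finite_imp_cone[OF weight(2) features l0 fin[unfolded \<Phi>]] unfolding \<Phi> by blast
    moreover have "lam \<noteq> 0" using cost_vector_nonzero[OF int c] lam(2) by auto
    ultimately show ?thesis using psd by metis
  qed
  have sufficient: "lp_finite Z \<omega> \<Phi> l (\<Phi> *v lam)" if "0 \<le> lam" for lam
    by (rule lp_finite_dual_feasible[OF weight(2) features l0 that])
  have realizable: "\<exists>c\<in>pos_measures Z \<omega>. cost_vector c = \<Phi> *v lam"
    if "X = UNIV" "U = UNIV" "0 \<le> lam" "lam \<noteq> 0" "psd (matricize (\<Phi> *v lam))" for lam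
  proof -
    have ZU: "Z = UNIV" using that by (simp add: Z)
    have w: "\<omega> \<in> borel_measurable borel"
      using weight(1) measurable_cong_sets[OF sets_restrict_UNIV refl] by (auto simp: ZU)
    obtain i where "lam $ i \<noteq> 0" using \<open>lam \<noteq> 0\<close> by (auto simp: vec_eq_iff)
    then have "0 < (\<Sum>i\<in>UNIV. lam $ i)"
      using \<open>0 \<le> lam\<close> by (intro sum_pos2[of _ i]) (auto simp: less_eq_vec_def less_le)
    \<comment> \<open>Each column of \<open>\<Phi>\<close> has the entry \<open>1 - \<gamma>\<close>
      at the constant monomial; this becomes the total mass of the realizing measure.\<close>
    then have "0 < (\<Phi> *v lam) $ (None, None)"
      using \<gamma> by (simp add: \<Phi> Phi_def matrix_vector_mult_def phi_entry mono1_def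
          flip: sum_distrib_left)
    then show ?thesis
      using psd_moment_matrix[OF w features[unfolded ZU] that(5)] by (auto simp: ZU)
  qed
  show ?thesis
  proof (intro conjI impI allI)
    assume UNIV: "X = UNIV \<and> U = UNIV"
    show "(\<exists>c\<in>pos_measures Z \<omega>. lp_finite Z \<omega> \<Phi> l (cost_vector c)) \<longleftrightarrow>
        (\<exists>lam. 0 \<le> lam \<and> lam \<noteq> 0 \<and> psd (matricize (\<Phi> *v lam)))"
    proof
      assume "\<exists>lam. 0 \<le> lam \<and> lam \<noteq> 0 \<and> psd (matricize (\<Phi> *v lam))"
      then obtain lam where "0 \<le> lam" "lam \<noteq> 0" "psd (matricize (\<Phi> *v lam))" by blast
      with realizable UNIV obtain c where "c \<in> pos_measures Z \<omega>" "cost_vector c = \<Phi> *v lam"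
        by blast
      with sufficient[OF \<open>0 \<le> lam\<close>] show "\<exists>c\<in>pos_measures Z \<omega>. lp_finite Z \<omega> \<Phi> l (cost_vector c)"
        by (intro bexI[of _ c]) simp_all
    qed (use necessary in blast)
  qed (use necessary sufficient realizable in blast)+
qed

end
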